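(* Let $(\Omega,\mathsf F,\mathbb P)$ be a probability space and let $(X,d)$ be a metric space with a fixed point $o\in X$. Let $X_0\subseteq X$ be totally bounded, let $D$ be such that $d(z,o)\le D$ for all $z\in X_0$, and let $\emptyset\neq F=\bigcap_{k\in\mathbb N}AF_k$ for a sequence $(AF_k)$ of measurable sets with $AF_{k+1}\subseteq AF_k\subseteq X_0$ for all $k\in\mathbb N$. Let $G:[0,\infty)\to[0,\infty)$ be strictly increasing and continuous with $G(0)=0$. Let $\mathcal F=(\mathcal F_n)$ be a filtration of $\mathsf F$ and let $(x_n)$ be a sequence of $X$-valued random variables which is uniformly stochastically quasi-Fejér monotone w.r.t. $F$, $(AF_k)$ and $\mathcal F$ (with this function $G$) and which has the stochastic $\liminf$-property w.r.t. $F$ and $(AF_k)$. Assume that $(d(x_n,o))$ is uniformly almost surely bounded, i.e. $\sup_{n\in\mathbb N}d(x_n,o)<\infty$ almost surely, and that $G(d(x_0,o)+D)$ has finite mean. Then $(x_n)$ is almost surely Cauchy.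
   Context: $X$ carries its Borel $\sigma$-algebra. $\ell^1_+(\mathcal F)$ is the set of sequences of nonnegative random variables adapted to $\mathcal F$ whose sum is almost surely finite. Uniform stochastic quasi-Fejér monotonicity of $(x_n)$ w.r.t. $F$, $(AF_k)$ and $\mathcal F$ (with $G$): $(x_n)$ is adapted to $\mathcal F$ and there are $(\eta_n),(\chi_n)\in\ell^1_+(\mathcal F)$ such that $$\forall\lambda>0\ \forall r,n\in\mathbb N\ \exists k\in\mathbb N\ \forall z\in AF_k\ \forall m\le n\ \Big(\mathbb P\big(\mathbb E[G(d(x_{m+1},z))\mid\mathcal F_m]>(1+\chi_m)G(d(x_m,z))+\eta_m+\tfrac1{r+1}\big)<\lambda\Big).$$ Stochastic $\liminf$-property of $(x_n)$ w.r.t. $F$ and $(AF_k)$: almost surely, for all $k,N\in\mathbb N$ there exists $n\ge N$ with $x_n\in AF_k$. *)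

theory Defs
  imports "HOL-Probability.Probability"
begin

definition adapted ::
  "(nat \<Rightarrow> 'w measure) \<Rightarrow> (nat \<Rightarrow> 'w \<Rightarrow> 'b::topological_space) \<Rightarrow> bool" where
  "adapted \<F> x \<longleftrightarrow> (\<forall>n. x n \<in> borel_measurable (\<F> n))"

definition ell1_plus ::
  "'w measure \<Rightarrow> (nat \<Rightarrow> 'w measure) \<Rightarrow> (nat \<Rightarrow> 'w \<Rightarrow> real) set" where
  "ell1_plus M \<F> = {\<eta>. adapted \<F> \<eta> \<and> (\<forall>n. \<forall>\<omega>\<in>space M. 0 \<le> \<eta> n \<omega>) \<and>
     (AE \<omega> in M. summable (\<lambda>n. \<eta> n \<omega>))}"

text \<open>
  The nonnegative variables \<open>G (dist (x (Suc m)) z)\<close> are not assumed integrable, so their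
  conditional expectation is the \<open>[0, \<infinity>]\<close>-valued one. The set \<open>F = (\<Inter>k. AF k)\<close> does not
  occur in the defining formulas of the two notions below and is therefore not a parameter.
\<close>

definition unif_stoch_quasi_Fejer ::
  "'w measure \<Rightarrow> (nat \<Rightarrow> 'w measure) \<Rightarrow> (real \<Rightarrow> real) \<Rightarrow>
   (nat \<Rightarrow> 'a::metric_space set) \<Rightarrow> (nat \<Rightarrow> 'w \<Rightarrow> 'a) \<Rightarrow> bool" where
  "unif_stoch_quasi_Fejer M \<F> G AF x \<longleftrightarrow>
     adapted \<F> x \<and>
     (\<exists>\<eta>\<in>ell1_plus M \<F>. \<exists>\<theta>\<in>ell1_plus M \<F>.
        \<forall>\<epsilon>>0. \<forall>r n::nat. \<exists>k. \<forall>z\<in>AF k. \<forall>m\<le>n.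
          measure M {\<omega>\<in>space M.
            nn_cond_exp M (\<F> m) (\<lambda>\<omega>'. ennreal (G (dist (x (Suc m) \<omega>') z))) \<omega>
              > ennreal ((1 + \<theta> m \<omega>) * G (dist (x m \<omega>) z) + \<eta> m \<omega> + 1 / (real r + 1))} < \<epsilon>)"

definition stoch_liminf_property ::
  "'w measure \<Rightarrow> (nat \<Rightarrow> 'a set) \<Rightarrow> (nat \<Rightarrow> 'w \<Rightarrow> 'a) \<Rightarrow> bool" where
  "stoch_liminf_property M AF x \<longleftrightarrow>
     (AE \<omega> in M. \<forall>k N. \<exists>n\<ge>N. x n \<omega> \<in> AF k)"

end

theory Submission
  imports Defs
begin

text \<open>
  Fix \<open>\<epsilon> > 0\<close>. It suffices to find, for every \<open>\<sigma> > 0\<close>, finitely many centres \<open>c\<close> such that, outside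
  an event of probability at most \<open>\<sigma>\<close>, the sequence eventually stays within \<open>\<epsilon>\<close> of one of them
  (\<open>AE_Cauchy_if_few_escapes\<close>). So the proof bounds the probability that \<open>(x n)\<close>, once it has come
  very close to a point of \<open>AF K\<close>, moves away from it again.

  Put \<open>b = G (\<epsilon> / 2)\<close> and choose \<open>\<rho>\<close> so small that \<open>G (2 * \<rho>) \<le> \<sigma> * b\<close>. Cover \<open>X\<^sub>0\<close> by finitely
  many \<open>\<rho>\<close>-balls. Since the sets \<open>AF k\<close> decrease, there is a single \<open>K\<close> such that \<open>AF K\<close> misses every
  ball that misses some \<open>AF k\<close>. Wait until a time \<open>N0\<close> after which \<open>\<eta> n + b * \<theta> n\<close> adds up to at
  most \<open>\<sigma> * b\<close>, except on an event of probability \<open>\<sigma>\<close>, and let \<open>n\<close> be the first time from \<open>N0\<close> on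
  with \<open>x n \<in> AF K\<close>, which exists almost surely. Then \<open>x n\<close> lies in a ball that meets all the
  sets \<open>AF k\<close>.

  For every horizon \<open>N\<close> the quasi-Fejer property provides a \<open>k\<close> such that every \<open>z \<in> AF k\<close> behaves like
  an exact solution up to time \<open>N\<close>, with small error and small exceptional probability. Choose such a
  \<open>z\<close> in the ball reached at time \<open>n\<close>. The process \<open>G (dist (x m) z)\<close> starts at time \<open>n\<close> below
  \<open>\<sigma> * b\<close>, and as long as it stays below \<open>b\<close> its conditional increments are at most
  \<open>\<eta> m + b * \<theta> m\<close> plus a small error. A maximal inequality for nonnegative almost supermartingales
  (\<open>maximal_inequality\<close>) then says that it reaches \<open>b\<close> before time \<open>N\<close> with conditional probability
  \<open>O(\<sigma>)\<close> only. The point \<open>z\<close> depends on \<open>N\<close>, but the centre of its ball does not; in terms of the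
  centre the estimate (\<open>few_escapes_before_horizon\<close>) is uniform in \<open>N\<close>, so \<open>N\<close> may tend to infinity
  (\<open>few_escapes\<close>).

  The inequality is applied separately on the pieces of the partition of the sample space given by the
  return time and the ball. Each piece contributes at most \<open>3 * \<sigma>\<close> times its own probability, so
  neither the number of balls nor the number of possible return times enters the bound. This
  is what allows \<open>\<rho>\<close> to be chosen depending on \<open>\<sigma>\<close>.
\<close>

section \<open>Filtered probability spaces\<close>

lemma ennreal_diff_split:
  fixes c d s :: ennreal
  assumes "c + d \<le> s" and "s < \<infinity>"
  shows "s - c = d + (s - (c + d))"
proof -
  obtain e where e: "s = c + d + e"
    using assms(1) le_iff_add by blast
  then have "c \<noteq> top" "d \<noteq> top"
    using assms(2) by auto
  then show ?thesis
    unfolding e by (simp add: add.assoc)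
      (metis add.assoc ennreal_add_diff_cancel_left ennreal_add_eq_top)
qed

locale filtered_prob_space = prob_space M + filtration "space M" \<F>
  for M :: "'w measure" and \<F> :: "nat \<Rightarrow> 'w measure" +
  assumes subalgebra_filtration: "subalgebra M (\<F> n)"
begin

lemma sigma_finite_subalgebra_filtration: "sigma_finite_subalgebra M (\<F> n)"
proof -
  interpret finite_measure_subalgebra M "\<F> n"
    by unfold_locales (rule subalgebra_filtration)
  show ?thesis
    by (rule sigma_finite_subalgebra_axioms)
qed

lemma measurable_filtration_mono:
  assumes "f \<in> measurable (\<F> i) N" and "i \<le> j"
  shows "f \<in> measurable (\<F> j) N"
  using assms sets_F_mono[OF \<open>i \<le> j\<close>] space_F[of i] space_F[of j]
  by (auto simp: measurable_def)

lemma sets_filtration_subset: "sets (\<F> n) \<subseteq> sets M"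
  using subalgebra_filtration[of n] by (simp add: subalgebra_def)

lemma nn_integral_cond_exp_on:
  assumes "L \<in> sets (\<F> m)" and "f \<in> borel_measurable M"
  shows "(\<integral>\<^sup>+\<omega>. indicator L \<omega> * nn_cond_exp M (\<F> m) f \<omega> \<partial>M) = (\<integral>\<^sup>+\<omega>. indicator L \<omega> * f \<omega> \<partial>M)"
  by (rule sigma_finite_subalgebra.nn_cond_exp_intg[OF sigma_finite_subalgebra_filtration])
    (use assms in auto)

lemma adapted_borel_measurable_filtration:
  assumes "adapted \<F> f" and "m \<le> n"
  shows "f m \<in> borel_measurable (\<F> n)"
  by (rule measurable_filtration_mono[OF _ assms(2)]) (use assms(1) in \<open>simp add: adapted_def\<close>)

lemma adapted_borel_measurable:
  assumes "adapted \<F> f"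
  shows "f n \<in> borel_measurable M"
  by (rule measurable_from_subalg[OF subalgebra_filtration
        adapted_borel_measurable_filtration[OF assms order_refl]])

section \<open>A maximal inequality for almost supermartingales\<close>

text \<open>
  Truncated at zero, by the subtraction of extended nonnegative reals: only upward conditional
  increments use up the budget \<open>s\<close> below.
\<close>
definition drift :: "(nat \<Rightarrow> 'w \<Rightarrow> ennreal) \<Rightarrow> nat \<Rightarrow> 'w \<Rightarrow> ennreal" where
  "drift V m \<omega> = nn_cond_exp M (\<F> m) (V (Suc m)) \<omega> - V m \<omega>"

lemma drift_measurable:
  assumes "adapted \<F> V"
  shows "drift V m \<in> borel_measurable (\<F> m)"
proof -
  have [measurable]: "V m \<in> borel_measurable (\<F> m)"
    using assms by (simp add: adapted_def)
  show ?thesis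
    unfolding drift_def[abs_def] by measurable
qed

lemma nn_cond_exp_le_drift: "nn_cond_exp M (\<F> m) (V (Suc m)) \<omega> \<le> V m \<omega> + drift V m \<omega>"
  unfolding drift_def by (meson ennreal_minus_le_iff order_refl)

text \<open>
  The event that, started on \<open>A\<close> at time \<open>n\<close> below \<open>b\<close>, the process reaches level \<open>b\<close> at some time in
  \<open>{n<..N}\<close> for the first time, and that the drift collected up to then does not exceed \<open>s\<close>. The sum stops at
  the last index before the hitting time because \<open>drift V m\<close> drives the step from \<open>m\<close> to \<open>Suc m\<close>.
\<close>
definition crossing ::
    "(nat \<Rightarrow> 'w \<Rightarrow> ennreal) \<Rightarrow> 'w set \<Rightarrow> nat \<Rightarrow> nat \<Rightarrow> ennreal \<Rightarrow> ennreal \<Rightarrow> 'w set" where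
  "crossing V A n N b s = {\<omega>\<in>A. \<exists>m\<in>{n..<N}. b \<le> V (Suc m) \<omega> \<and> (\<forall>i\<in>{n..m}. V i \<omega> < b) \<and>
     (\<Sum>i\<in>{n..m}. drift V i \<omega>) \<le> s}"

text \<open>
  With \<open>S m\<close> the drift collected on \<open>{n..<m}\<close>, the potential \<open>V m + (s - S m)\<close> is a supermartingale as
  long as \<open>S m \<le> s\<close>. It starts on \<open>A\<close> at most at \<open>a + s\<close>, stays nonnegative, and is at least \<open>b\<close> at
  a crossing, which is Doob's argument for the maximal inequality.
\<close>
lemma maximal_inequality:
  fixes V :: "nat \<Rightarrow> 'w \<Rightarrow> ennreal" and a b s :: ennreal
  assumes adapted: "adapted \<F> V"
    and A: "A \<in> sets (\<F> n)" and start: "\<And>\<omega>. \<omega> \<in> A \<Longrightarrow> V n \<omega> \<le> a"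
    and "s < \<infinity>" and "n \<le> N"
  shows crossing_sets: "crossing V A n N b s \<in> sets M"
    and "b * emeasure M (crossing V A n N b s) \<le> (a + s) * emeasure M A"
proof -
  have V_F: "V i \<in> borel_measurable (\<F> j)" if "i \<le> j" for i j
    using adapted_borel_measurable_filtration[OF adapted that] .
  have D_F: "drift V i \<in> borel_measurable (\<F> j)" if "i \<le> j" for i j
    using measurable_filtration_mono[OF drift_measurable[OF adapted] that] .
  have V_M [measurable]: "V i \<in> borel_measurable M" for i
    using adapted_borel_measurable[OF adapted] .
  have D_M [measurable]: "drift V i \<in> borel_measurable M" for i
    using D_F[of i i] measurable_from_subalg[OF subalgebra_filtration] by blast
  define S where "S m \<omega> = (\<Sum>i\<in>{n..<m}. drift V i \<omega>)" for m \<omega>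
  define Z where "Z m \<omega> = V m \<omega> + (s - S m \<omega>)" for m \<omega>
  \<comment> \<open>\<open>L m\<close>: not yet crossed at time \<open>m\<close>, with enough budget left for the step to \<open>Suc m\<close>. It is known at
      time \<open>m\<close> because \<open>S (Suc m)\<close> is predictable.\<close>
  define L where "L m = {\<omega>\<in>A. (\<forall>i\<in>{n..m}. V i \<omega> < b) \<and> S (Suc m) \<omega> \<le> s}" for m
  define H where "H m = {\<omega>\<in>L m. b \<le> V (Suc m) \<omega>}" for m
  have S_M [measurable]: "S m \<in> borel_measurable M" for m
    unfolding S_def[abs_def] by measurable
  have Z_M [measurable]: "Z m \<in> borel_measurable M" for m
    unfolding Z_def[abs_def] by measurable
  have L_F: "L m \<in> sets (\<F> m)" if "n \<le> m" for m
  proof -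
    have A_m: "A \<in> sets (\<F> m)"
      using A sets_F_mono[OF that] by auto
    have A_sub: "A \<subseteq> space (\<F> m)"
      using sets.sets_into_space[OF A_m] .
    have S_m [measurable]: "S (Suc m) \<in> borel_measurable (\<F> m)"
      unfolding S_def[abs_def] by (intro borel_measurable_sum D_F) auto
    have V_m: "Measurable.pred (\<F> m) (\<lambda>\<omega>. \<forall>i\<in>{n..m}. V i \<omega> < b)"
      by (intro pred_intros_finite) (auto intro!: borel_measurable_const measurable_compose[OF V_F])
    have "L m = A \<inter> {\<omega>\<in>space (\<F> m). (\<forall>i\<in>{n..m}. V i \<omega> < b) \<and> S (Suc m) \<omega> \<le> s}"
      using A_sub by (auto simp: L_def)
    moreover have "{\<omega>\<in>space (\<F> m). (\<forall>i\<in>{n..m}. V i \<omega> < b) \<and> S (Suc m) \<omega> \<le> s} \<in> sets (\<F> m)"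
      using V_m by measurable
    ultimately show ?thesis
      using A_m by auto
  qed
  have L_M: "L m \<in> sets M" if "n \<le> m" for m
    using L_F[OF that] sets_filtration_subset by blast
  have H_M: "H m \<in> sets M" if "n \<le> m" for m
  proof -
    have "H m = L m \<inter> {\<omega>\<in>space M. b \<le> V (Suc m) \<omega>}"
      using sets.sets_into_space[OF L_M[OF that]] by (auto simp: H_def)
    then show ?thesis
      using L_M[OF that] by auto
  qed
  \<comment> \<open>The potential does not increase on \<open>L m\<close>; the part of \<open>L m\<close> that crosses carries at least \<open>b\<close>, and
      the part whose budget runs out is dropped, being nonnegative.\<close>
  have potential_step: "b * emeasure M (H m) + (\<integral>\<^sup>+\<omega>. indicator (L (Suc m)) \<omega> * Z (Suc m) \<omega> \<partial>M)
      \<le> (\<integral>\<^sup>+\<omega>. indicator (L m) \<omega> * Z m \<omega> \<partial>M)" if "n \<le> m" for m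
  proof -
    note [measurable] = L_M[OF that] H_M[OF that] L_M[OF le_SucI[OF that]]
    have "b * emeasure M (H m) + (\<integral>\<^sup>+\<omega>. indicator (L (Suc m)) \<omega> * Z (Suc m) \<omega> \<partial>M)
        = (\<integral>\<^sup>+\<omega>. b * indicator (H m) \<omega> + indicator (L (Suc m)) \<omega> * Z (Suc m) \<omega> \<partial>M)"
      by (simp add: nn_integral_add nn_integral_cmult)
    also have "\<dots> \<le> (\<integral>\<^sup>+\<omega>. indicator (L m) \<omega> * Z (Suc m) \<omega> \<partial>M)"
    proof (rule nn_integral_mono)
      fix \<omega>
      have "S (Suc m) \<omega> \<le> S (Suc (Suc m)) \<omega>"
        unfolding S_def by (rule sum_mono2) auto
      then have "L (Suc m) \<subseteq> {\<omega>. V (Suc m) \<omega> < b}" "\<omega> \<in> L (Suc m) \<Longrightarrow> \<omega> \<in> L m"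
        using that by (auto simp: L_def)
      then show "b * indicator (H m) \<omega> + indicator (L (Suc m)) \<omega> * Z (Suc m) \<omega>
          \<le> indicator (L m) \<omega> * Z (Suc m) \<omega>"
        by (auto simp: H_def Z_def indicator_def intro: add_increasing2)
    qed
    also have "\<dots> = (\<integral>\<^sup>+\<omega>. indicator (L m) \<omega> * V (Suc m) \<omega> \<partial>M)
        + (\<integral>\<^sup>+\<omega>. indicator (L m) \<omega> * (s - S (Suc m) \<omega>) \<partial>M)"
      unfolding Z_def by (simp add: distrib_left nn_integral_add)
    also have "\<dots> = (\<integral>\<^sup>+\<omega>. indicator (L m) \<omega> * nn_cond_exp M (\<F> m) (V (Suc m)) \<omega> \<partial>M)
        + (\<integral>\<^sup>+\<omega>. indicator (L m) \<omega> * (s - S (Suc m) \<omega>) \<partial>M)"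
      by (subst nn_integral_cond_exp_on[OF L_F[OF that]]) auto
    also have "\<dots> = (\<integral>\<^sup>+\<omega>. indicator (L m) \<omega> *
        (nn_cond_exp M (\<F> m) (V (Suc m)) \<omega> + (s - S (Suc m) \<omega>)) \<partial>M)"
      by (simp add: distrib_left nn_integral_add)
    also have "\<dots> \<le> (\<integral>\<^sup>+\<omega>. indicator (L m) \<omega> * Z m \<omega> \<partial>M)"
    proof (rule nn_integral_mono)
      fix \<omega>
      have S_Suc: "S (Suc m) \<omega> = S m \<omega> + drift V m \<omega>"
        using that by (simp add: S_def)
      have "nn_cond_exp M (\<F> m) (V (Suc m)) \<omega> + (s - S (Suc m) \<omega>) \<le> Z m \<omega>" if "\<omega> \<in> L m"
      proof -
        have "s - S m \<omega> = drift V m \<omega> + (s - S (Suc m) \<omega>)"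
          using that \<open>s < \<infinity>\<close> ennreal_diff_split[of "S m \<omega>" "drift V m \<omega>" s]
          by (simp add: S_Suc[symmetric] L_def)
        then show ?thesis
          using add_right_mono[OF nn_cond_exp_le_drift, of m V \<omega> "s - S (Suc m) \<omega>"]
          by (simp add: Z_def add.assoc)
      qed
      then show "indicator (L m) \<omega> * (nn_cond_exp M (\<F> m) (V (Suc m)) \<omega> + (s - S (Suc m) \<omega>))
          \<le> indicator (L m) \<omega> * Z m \<omega>"
        by (auto simp: indicator_def)
    qed
    finally show ?thesis .
  qed
  have A_M: "A \<in> sets M"
    using A sets_filtration_subset by blast
  have "(\<Sum>m\<in>{n..<N}. b * emeasure M (H m)) + (\<integral>\<^sup>+\<omega>. indicator (L N) \<omega> * Z N \<omega> \<partial>M)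
      \<le> (a + s) * emeasure M A"
    using \<open>n \<le> N\<close>
  proof (induction N rule: dec_induct)
    case base
    have "(\<integral>\<^sup>+\<omega>. indicator (L n) \<omega> * Z n \<omega> \<partial>M) \<le> (\<integral>\<^sup>+\<omega>. (a + s) * indicator A \<omega> \<partial>M)"
      by (rule nn_integral_mono)
        (auto simp: L_def Z_def S_def indicator_def intro!: add_mono start)
    also have "\<dots> = (a + s) * emeasure M A"
      using A_M by (simp add: nn_integral_cmult)
    finally show ?case by simp
  next
    case (step m)
    have "(\<Sum>i\<in>{n..<Suc m}. b * emeasure M (H i)) + (\<integral>\<^sup>+\<omega>. indicator (L (Suc m)) \<omega> * Z (Suc m) \<omega> \<partial>M)
      = (\<Sum>i\<in>{n..<m}. b * emeasure M (H i)) +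
        (b * emeasure M (H m) + (\<integral>\<^sup>+\<omega>. indicator (L (Suc m)) \<omega> * Z (Suc m) \<omega> \<partial>M))"
      using step.hyps by (simp add: add.assoc)
    also have "\<dots> \<le> (\<Sum>i\<in>{n..<m}. b * emeasure M (H i)) + (\<integral>\<^sup>+\<omega>. indicator (L m) \<omega> * Z m \<omega> \<partial>M)"
      by (intro add_left_mono potential_step step.hyps)
    finally show ?case
      using step.IH by (rule order_trans)
  qed
  then have sum_le: "(\<Sum>m\<in>{n..<N}. b * emeasure M (H m)) \<le> (a + s) * emeasure M A"
    by (rule order_trans[rotated]) (simp add: le_iff_add)
  have crossing_eq: "crossing V A n N b s = (\<Union>m\<in>{n..<N}. H m)"
    by (auto simp: crossing_def H_def L_def S_def atLeastLessThanSuc_atLeastAtMost)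
  then show "crossing V A n N b s \<in> sets M"
    using H_M by auto
  have "b * emeasure M (crossing V A n N b s) \<le> b * (\<Sum>m\<in>{n..<N}. emeasure M (H m))"
    unfolding crossing_eq using H_M by (auto intro!: mult_left_mono emeasure_subadditive_finite)
  also have "\<dots> \<le> (a + s) * emeasure M A"
    using sum_le by (simp add: sum_distrib_left)
  finally show "b * emeasure M (crossing V A n N b s) \<le> (a + s) * emeasure M A" .
qed
section \<open>Escapes before a finite horizon\<close>

lemma summable_uniform_tail:
  fixes \<kappa> :: "nat \<Rightarrow> 'w \<Rightarrow> real"
  assumes [measurable]: "\<And>n. \<kappa> n \<in> borel_measurable M"
    and nonneg: "\<And>n \<omega>. \<omega> \<in> space M \<Longrightarrow> 0 \<le> \<kappa> n \<omega>"
    and summable: "AE \<omega> in M. summable (\<lambda>n. \<kappa> n \<omega>)"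
    and "0 < \<delta>" "0 < \<sigma>"
  shows "\<exists>n. prob {\<omega>\<in>space M. \<exists>l. \<delta> < (\<Sum>i\<in>{n..<l}. \<kappa> i \<omega>)} \<le> \<sigma>"
proof -
  define T where "T n = {\<omega>\<in>space M. \<exists>l. \<delta> < (\<Sum>i\<in>{n..<l}. \<kappa> i \<omega>)}" for n
  have T_sets: "range T \<subseteq> sets M"
    unfolding T_def by auto
  have "decseq T"
  proof (intro decseq_SucI subsetI)
    fix n \<omega> assume "\<omega> \<in> T (Suc n)"
    then obtain l where \<omega>: "\<omega> \<in> space M" and l: "\<delta> < (\<Sum>i\<in>{Suc n..<l}. \<kappa> i \<omega>)"
      by (auto simp: T_def)
    have "(\<Sum>i\<in>{Suc n..<l}. \<kappa> i \<omega>) \<le> (\<Sum>i\<in>{n..<l}. \<kappa> i \<omega>)"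
      using nonneg[OF \<omega>] by (intro sum_mono2) auto
    then show "\<omega> \<in> T n"
      using \<omega> l by (auto simp: T_def intro: less_le_trans)
  qed
  moreover have "prob (\<Inter>n. T n) = 0"
  proof -
    have "AE \<omega> in M. \<omega> \<notin> (\<Inter>n. T n)"
      using summable
    proof eventually_elim
      case (elim \<omega>)
      then obtain n where "\<And>m l. n \<le> m \<Longrightarrow> norm (\<Sum>i\<in>{m..<l}. \<kappa> i \<omega>) < \<delta>"
        using \<open>0 < \<delta>\<close> unfolding summable_Cauchy by blast
      from this[of n] have "\<omega> \<notin> T n"
        by (auto simp: T_def not_less intro: order.trans[OF abs_ge_self] less_imp_le)
      then show ?case by blast
    qed
    then show ?thesis
      using T_sets by (subst prob_eq_0) auto
  qed
  ultimately have "(\<lambda>n. prob (T n)) \<longlonglongrightarrow> 0"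
    using finite_Lim_measure_decseq[OF T_sets] by simp
  then have "eventually (\<lambda>n. prob (T n) < \<sigma>) sequentially"
    using \<open>0 < \<sigma>\<close> by (rule order_tendstoD)
  then show ?thesis
    unfolding T_def by (metis (lifting) eventually_sequentially less_imp_le order_refl)
qed

lemma dist_borel_measurable:
  fixes f :: "'w \<Rightarrow> 'a::metric_space"
  assumes "f \<in> borel_measurable N"
  shows "(\<lambda>\<omega>. dist (f \<omega>) c) \<in> borel_measurable N"
  by (rule measurable_compose[OF assms borel_measurable_continuous_onI]) (intro continuous_intros)

text \<open>
  Here \<open>A n c\<close> is the event that \<open>n\<close> is the relevant return time and that \<open>c\<close> is the centre of the ball
  reached then. The bound is \<open>\<sigma>\<close> for a failure of the quasi-Fejer inequality, \<open>\<sigma>\<close> for a heavy tail of the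
  error terms, and \<open>3 * \<sigma>\<close> from the maximal inequality, summed over the disjoint events \<open>A n c\<close>. It does
  not depend on \<open>N\<close>, whereas the approximate solutions chosen in the proof do.
\<close>
lemma few_escapes_before_horizon:
  fixes x :: "nat \<Rightarrow> 'w \<Rightarrow> 'a::metric_space" and G :: "real \<Rightarrow> real"
    and \<eta> \<theta> :: "nat \<Rightarrow> 'w \<Rightarrow> real" and AF :: "nat \<Rightarrow> 'a set" and A :: "nat \<Rightarrow> 'a \<Rightarrow> 'w set"
  assumes x: "adapted \<F> x" and \<eta>: "\<eta> \<in> ell1_plus M \<F>" and \<theta>: "\<theta> \<in> ell1_plus M \<F>"
    and G_nonneg: "\<And>t. 0 \<le> t \<Longrightarrow> 0 \<le> G t" and G_mono: "strict_mono_on {0..} G"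
    and G_cont: "continuous_on {0..} G"
    and Fejer: "\<forall>\<tau>>0. \<forall>r n::nat. \<exists>k. \<forall>z\<in>AF k. \<forall>m\<le>n.
      prob {\<omega>\<in>space M. nn_cond_exp M (\<F> m) (\<lambda>\<omega>'. ennreal (G (dist (x (Suc m) \<omega>') z))) \<omega>
        > ennreal ((1 + \<theta> m \<omega>) * G (dist (x m \<omega>) z) + \<eta> m \<omega> + 1 / (real r + 1))} < \<tau>"
    and C: "finite C" "\<And>c k. c \<in> C \<Longrightarrow> \<exists>z\<in>AF k. dist z c < \<rho>"
    and A: "\<And>n c. A n c \<in> sets (\<F> n)" "\<And>n c \<omega>. \<omega> \<in> A n c \<Longrightarrow> dist (x n \<omega>) c < \<rho>"
      "disjoint_family_on (\<lambda>(n, c). A n c) ({N0..} \<times> C)"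
    and pos: "0 < \<rho>" "4 * \<rho> \<le> \<epsilon>" "0 < \<sigma>" "0 < G (\<epsilon> / 2)"
    and small: "G (2 * \<rho>) \<le> \<sigma> * G (\<epsilon> / 2)"
    and tail: "prob {\<omega>\<in>space M. \<exists>l. \<sigma> * G (\<epsilon> / 2) < (\<Sum>i\<in>{N0..<l}. \<eta> i \<omega> + G (\<epsilon> / 2) * \<theta> i \<omega>)} \<le> \<sigma>"
  shows "prob {\<omega>\<in>space M. \<exists>n\<in>{N0..N}. \<exists>c\<in>C. \<exists>m\<in>{n..N}. \<omega> \<in> A n c \<and> \<epsilon> < dist (x m \<omega>) c} \<le> 5 * \<sigma>"
proof -
  define b where "b = G (\<epsilon> / 2)"
  have "0 < b" using pos by (simp add: b_def)
  have G_less: "G s < G t" if "0 \<le> s" "s < t" for s t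
    using G_mono that by (auto simp: strict_mono_on_def)
  have G_le: "G s \<le> G t" if "0 \<le> s" "s \<le> t" for s t
    using G_less[of s t] that by (cases "s = t") auto
  \<comment> \<open>The errors \<open>1 / (r + 1)\<close> of all steps up to the horizon add up to at most \<open>\<sigma> * b\<close>, and the exceptional
      probabilities \<open>\<tau>\<close> of all steps and centres to at most \<open>\<sigma>\<close>; \<open>Suc (card C)\<close> avoids a zero
      denominator.\<close>
  obtain r :: nat where r: "real (Suc N) / (\<sigma> * b) < real r"
    using reals_Archimedean2 by blast
  have r_le: "real (Suc N) * (1 / (real r + 1)) \<le> \<sigma> * b"
  proof -
    have "real (Suc N) < real r * (\<sigma> * b)"
      using r \<open>0 < b\<close> \<open>0 < \<sigma>\<close> by (simp add: field_simps)
    also have "\<dots> \<le> (real r + 1) * (\<sigma> * b)"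
      using \<open>0 < b\<close> \<open>0 < \<sigma>\<close> by (intro mult_right_mono) auto
    finally show ?thesis
      by (simp add: field_simps)
  qed
  define \<tau> where "\<tau> = \<sigma> / (real (Suc (card C)) * real (Suc N))"
  have "0 < \<tau>" using \<open>0 < \<sigma>\<close> by (simp add: \<tau>_def)
  then obtain k where k: "\<And>z m. z \<in> AF k \<Longrightarrow> m \<le> N \<Longrightarrow>
      prob {\<omega>\<in>space M. nn_cond_exp M (\<F> m) (\<lambda>\<omega>'. ennreal (G (dist (x (Suc m) \<omega>') z))) \<omega>
        > ennreal ((1 + \<theta> m \<omega>) * G (dist (x m \<omega>) z) + \<eta> m \<omega> + 1 / (real r + 1))} < \<tau>"
    using Fejer by blast
  obtain z where z: "\<And>c. c \<in> C \<Longrightarrow> z c \<in> AF k" "\<And>c. c \<in> C \<Longrightarrow> dist (z c) c < \<rho>"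
    using C(2)[of _ k] by metis
  have x_F: "x m \<in> borel_measurable (\<F> m)" for m
    using adapted_borel_measurable_filtration[OF x order_refl] .
  have x_M: "x m \<in> borel_measurable M" for m
    using adapted_borel_measurable[OF x] .
  have G_F: "(\<lambda>\<omega>. G (dist (x m \<omega>) u)) \<in> borel_measurable (\<F> m)" for m u
  proof -
    \<comment> \<open>\<open>G\<close> is continuous on the nonnegative reals only; composing with \<open>max 0\<close> gives a function that is
        continuous everywhere and agrees with \<open>G\<close> on distances.\<close>
    have "continuous_on UNIV (\<lambda>t. G (max 0 t))"
      by (rule continuous_on_compose2[OF G_cont]) (auto intro!: continuous_intros)
    from measurable_compose[OF dist_borel_measurable[OF x_F] borel_measurable_continuous_onI[OF this]]
    show ?thesis by simp
  qed
  have G_M [measurable]: "(\<lambda>\<omega>. G (dist (x m \<omega>) u)) \<in> borel_measurable M" for m u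
    using measurable_from_subalg[OF subalgebra_filtration G_F] .
  have dist_M [measurable]: "(\<lambda>\<omega>. dist (x m \<omega>) u) \<in> borel_measurable M" for m u
    using dist_borel_measurable[OF x_M] .
  have \<eta>_M [measurable]: "\<eta> m \<in> borel_measurable M" and \<theta>_M [measurable]: "\<theta> m \<in> borel_measurable M" for m
    using \<eta> \<theta> by (simp_all add: ell1_plus_def adapted_borel_measurable)
  have \<eta>_nonneg: "0 \<le> \<eta> m \<omega>" and \<theta>_nonneg: "0 \<le> \<theta> m \<omega>" if "\<omega> \<in> space M" for m \<omega>
    using \<eta> \<theta> that by (simp_all add: ell1_plus_def)
  define V where "V c m \<omega> = ennreal (G (dist (x m \<omega>) (z c)))" for c m \<omega>
  have V_adapted: "adapted \<F> (V c)" for c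
    using G_F by (auto simp: adapted_def V_def[abs_def])
  define E where "E c m = {\<omega>\<in>space M. nn_cond_exp M (\<F> m) (V c (Suc m)) \<omega>
        > ennreal ((1 + \<theta> m \<omega>) * G (dist (x m \<omega>) (z c)) + \<eta> m \<omega> + 1 / (real r + 1))}" for c m
  have cond_M [measurable]: "nn_cond_exp M (\<F> m) f \<in> borel_measurable M" for m f
    by (rule borel_measurable_nn_cond_exp2)
  have E_M: "E c m \<in> sets M" for c m
    unfolding E_def by measurable
  have E_prob: "prob (E c m) \<le> \<tau>" if "c \<in> C" "m \<le> N" for c m
    using k[OF z(1) that(2)] that(1) unfolding E_def V_def[abs_def] by (simp add: less_imp_le)
  define Ex where "Ex = (\<Union>c\<in>C. \<Union>m\<le>N. E c m)"
  have Ex_M: "Ex \<in> sets M"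
    unfolding Ex_def using C(1) E_M by (intro sets.finite_UN) auto
  have "prob Ex \<le> (\<Sum>c\<in>C. \<Sum>m\<le>N. prob (E c m))"
    unfolding Ex_def using C(1) E_M
    by (intro order.trans[OF finite_measure_subadditive_finite] sum_mono finite_measure_subadditive_finite
        sets.finite_UN) auto
  also have "\<dots> \<le> (\<Sum>c\<in>C. \<Sum>m\<le>N. \<tau>)"
    using E_prob by (intro sum_mono) auto
  also have "\<dots> = real (card C) / real (Suc (card C)) * \<sigma>"
    by (simp add: \<tau>_def)
  also have "\<dots> \<le> 1 * \<sigma>"
    using \<open>0 < \<sigma>\<close> by (intro mult_right_mono) (auto simp: field_simps)
  finally have Ex_prob: "prob Ex \<le> \<sigma>" by simp
  define Tl where "Tl = {\<omega>\<in>space M. \<exists>l. \<sigma> * b < (\<Sum>i\<in>{N0..<l}. \<eta> i \<omega> + b * \<theta> i \<omega>)}"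
  have Tl_M: "Tl \<in> sets M"
    unfolding Tl_def by measurable
  have Tl_prob: "prob Tl \<le> \<sigma>"
    using tail by (simp add: Tl_def b_def)
  \<comment> \<open>Budget \<open>2 * \<sigma> * b\<close>: one half for the tails of \<open>\<eta>\<close> and \<open>\<theta>\<close>, the other for the errors \<open>1 / (r + 1)\<close>.\<close>
  define Hit where "Hit n c = crossing (V c) (A n c) n N (ennreal b) (ennreal (2 * \<sigma> * b))" for n c
  have A_M: "A n c \<in> sets M" for n c
    using A(1) sets_filtration_subset by blast
  have near: "dist (x n \<omega>) (z c) < 2 * \<rho>" if "\<omega> \<in> A n c" "c \<in> C" for n c \<omega>
    using A(2)[OF that(1)] z(2)[OF that(2)] dist_triangle2[of "x n \<omega>" "z c" c] by simp
  have Hit: "Hit n c \<in> sets M" "prob (Hit n c) \<le> 3 * \<sigma> * prob (A n c)" if "n \<le> N" "c \<in> C" for n c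
  proof -
    have start: "V c n \<omega> \<le> ennreal (G (2 * \<rho>))" if "\<omega> \<in> A n c" for \<omega>
      unfolding V_def using near[OF that \<open>c \<in> C\<close>] by (intro ennreal_leI G_le) auto
    note max_ineq = maximal_inequality[OF V_adapted A(1) start _ that(1),
        where s = "ennreal (2 * \<sigma> * b)" and b = "ennreal b"]
    show "Hit n c \<in> sets M"
      unfolding Hit_def by (rule max_ineq) auto
    have "0 \<le> G (2 * \<rho>)" using G_nonneg pos by simp
    have ennreal_sum: "ennreal (G (2 * \<rho>) + 2 * \<sigma> * b) = ennreal (G (2 * \<rho>)) + ennreal (2 * \<sigma> * b)"
      using \<open>0 < b\<close> \<open>0 < \<sigma>\<close> \<open>0 \<le> G (2 * \<rho>)\<close> by (intro ennreal_plus) auto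
    have "ennreal b * emeasure M (Hit n c) \<le> (ennreal (G (2 * \<rho>)) + ennreal (2 * \<sigma> * b)) * emeasure M (A n c)"
      unfolding Hit_def by (rule max_ineq) auto
    then have "ennreal (b * prob (Hit n c)) \<le> ennreal ((G (2 * \<rho>) + 2 * \<sigma> * b) * prob (A n c))"
      by (simp only: emeasure_eq_measure ennreal_sum ennreal_mult''[OF measure_nonneg])
    then have "b * prob (Hit n c) \<le> (G (2 * \<rho>) + 2 * \<sigma> * b) * prob (A n c)"
      using \<open>0 < b\<close> \<open>0 < \<sigma>\<close> \<open>0 \<le> G (2 * \<rho>)\<close> by (subst (asm) ennreal_le_iff) auto
    also have "\<dots> \<le> (3 * \<sigma> * b) * prob (A n c)"
      using small by (intro mult_right_mono) (auto simp: b_def)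
    finally show "prob (Hit n c) \<le> 3 * \<sigma> * prob (A n c)"
      using \<open>0 < b\<close> by (simp add: mult.assoc mult.left_commute)
  qed
  let ?I = "{N0..N} \<times> C"
  define Hits where "Hits = (\<Union>(n, c)\<in>?I. Hit n c)"
  have fin: "finite ?I" using C(1) by simp
  have Hits_M: "Hits \<in> sets M"
    unfolding Hits_def using fin Hit(1) by (intro sets.finite_UN) auto
  have "prob Hits \<le> (\<Sum>(n, c)\<in>?I. prob (Hit n c))"
    unfolding Hits_def using fin Hit(1)
    by (intro order.trans[OF finite_measure_subadditive_finite]) (auto simp: case_prod_beta)
  also have "\<dots> \<le> (\<Sum>(n, c)\<in>?I. 3 * \<sigma> * prob (A n c))"
    using Hit(2) by (intro sum_mono) auto
  also have "\<dots> = 3 * \<sigma> * (\<Sum>i\<in>?I. prob ((\<lambda>(n, c). A n c) i))"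
    by (simp add: sum_distrib_left case_prod_beta)
  also have "(\<Sum>i\<in>?I. prob ((\<lambda>(n, c). A n c) i)) = prob (\<Union>i\<in>?I. (\<lambda>(n, c). A n c) i)"
    using fin A_M disjoint_family_on_mono[OF Sigma_mono[OF _ order_refl] A(3), of "{N0..N}"]
    by (intro finite_measure_finite_Union[symmetric]) auto
  also have "3 * \<sigma> * \<dots> \<le> 3 * \<sigma> * 1"
    using \<open>0 < \<sigma>\<close> by (intro mult_left_mono prob_le_1) auto
  finally have Hits_prob: "prob Hits \<le> 3 * \<sigma>" by simp
  have "{\<omega>\<in>space M. \<exists>n\<in>{N0..N}. \<exists>c\<in>C. \<exists>m\<in>{n..N}. \<omega> \<in> A n c \<and> \<epsilon> < dist (x m \<omega>) c} \<subseteq> Ex \<union> Tl \<union> Hits"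
  proof (rule subsetI, rule ccontr)
    fix \<omega> assume "\<omega> \<in> {\<omega>\<in>space M. \<exists>n\<in>{N0..N}. \<exists>c\<in>C. \<exists>m\<in>{n..N}. \<omega> \<in> A n c \<and> \<epsilon> < dist (x m \<omega>) c}"
      and out: "\<omega> \<notin> Ex \<union> Tl \<union> Hits"
    then obtain n c m where \<omega>: "\<omega> \<in> space M" and n: "N0 \<le> n" "n \<le> N" and c: "c \<in> C"
      and m: "n \<le> m" "m \<le> N" and A_\<omega>: "\<omega> \<in> A n c" and far: "\<epsilon> < dist (x m \<omega>) c"
      by auto
    define g where "g i = G (dist (x i \<omega>) (z c))" for i
    have g_nonneg: "0 \<le> g i" for i
      using G_nonneg by (simp add: g_def)
    have "\<epsilon> / 2 \<le> dist (x m \<omega>) (z c)"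
      using far z(2)[OF c] pos dist_triangle[of "x m \<omega>" c "z c"] by simp
    then have g_m: "b \<le> g m"
      unfolding g_def b_def using pos by (intro G_le) auto
    have g_n: "g n < b"
      unfolding g_def b_def using near[OF A_\<omega> c] pos by (intro G_less) auto
    \<comment> \<open>The first time from \<open>n\<close> on at which level \<open>b\<close> is reached.\<close>
    define l where "l = (LEAST i. n \<le> i \<and> b \<le> g i)"
    have l: "n \<le> l" "b \<le> g l"
      using LeastI[of "\<lambda>i. n \<le> i \<and> b \<le> g i" m] m(1) g_m by (auto simp: l_def)
    have "l \<le> m"
      using m(1) g_m by (auto simp: l_def intro: Least_le)
    have below: "g i < b" if "n \<le> i" "i < l" for i
      using not_less_Least[of i "\<lambda>i. n \<le> i \<and> b \<le> g i"] that by (auto simp: l_def)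
    have "l \<noteq> n" using l(2) g_n by auto
    then obtain l' where l': "l = Suc l'" "n \<le> l'"
      using l(1) by (cases l) auto
    have drift_le: "drift (V c) i \<omega> \<le> ennreal (\<eta> i \<omega> + b * \<theta> i \<omega> + 1 / (real r + 1))"
      if "i \<in> {n..l'}" for i
    proof -
      have i: "n \<le> i" "i < l" "i \<le> N"
        using that l' \<open>l \<le> m\<close> m by auto
      have "\<omega> \<notin> E c i"
        using out c i by (auto simp: Ex_def)
      then have "nn_cond_exp M (\<F> i) (V c (Suc i)) \<omega>
          \<le> ennreal ((1 + \<theta> i \<omega>) * g i + \<eta> i \<omega> + 1 / (real r + 1))"
        using \<omega> by (simp add: E_def g_def not_less)
      \<comment> \<open>Before the crossing \<open>g i < b\<close>, so the multiplicative error \<open>\<theta> i * g i\<close> is at most the additive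
          error \<open>b * \<theta> i\<close>.\<close>
      also have "\<dots> \<le> ennreal (g i + (\<eta> i \<omega> + b * \<theta> i \<omega> + 1 / (real r + 1)))"
        using mult_left_mono[OF less_imp_le[OF below[OF i(1,2)]] \<theta>_nonneg[OF \<omega>, of i]]
        by (intro ennreal_leI) (simp add: algebra_simps)
      also have "\<dots> = V c i \<omega> + ennreal (\<eta> i \<omega> + b * \<theta> i \<omega> + 1 / (real r + 1))"
        using g_nonneg \<eta>_nonneg[OF \<omega>] \<theta>_nonneg[OF \<omega>] \<open>0 < b\<close>
        unfolding V_def g_def[symmetric] by (subst ennreal_plus) auto
      finally show ?thesis
        unfolding drift_def by (auto simp: ennreal_minus_le_iff V_def)
    qed
    have "(\<Sum>i\<in>{n..l'}. \<eta> i \<omega> + b * \<theta> i \<omega>) \<le> (\<Sum>i\<in>{N0..<Suc l'}. \<eta> i \<omega> + b * \<theta> i \<omega>)"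
      using n(1) \<eta>_nonneg[OF \<omega>] \<theta>_nonneg[OF \<omega>] \<open>0 < b\<close> by (intro sum_mono2) auto
    also have "\<dots> \<le> \<sigma> * b"
      using out \<omega> unfolding Tl_def not_less[symmetric] by blast
    finally have tail_le: "(\<Sum>i\<in>{n..l'}. \<eta> i \<omega> + b * \<theta> i \<omega>) \<le> \<sigma> * b" .
    have "real (Suc l' - n) * (1 / (real r + 1)) \<le> real (Suc N) * (1 / (real r + 1))"
      using l' \<open>l \<le> m\<close> m by (intro mult_right_mono) auto
    also have "\<dots> \<le> \<sigma> * b"
      by (rule r_le)
    finally have "real (Suc l' - n) * (1 / (real r + 1)) \<le> \<sigma> * b" .
    moreover have "(\<Sum>i\<in>{n..l'}. \<eta> i \<omega> + b * \<theta> i \<omega> + 1 / (real r + 1)) =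
        (\<Sum>i\<in>{n..l'}. \<eta> i \<omega> + b * \<theta> i \<omega>) + real (Suc l' - n) * (1 / (real r + 1))"
      by (subst sum.distrib) simp
    ultimately have sum_le: "(\<Sum>i\<in>{n..l'}. \<eta> i \<omega> + b * \<theta> i \<omega> + 1 / (real r + 1)) \<le> 2 * \<sigma> * b"
      using tail_le by linarith
    have "(\<Sum>i\<in>{n..l'}. drift (V c) i \<omega>) \<le> (\<Sum>i\<in>{n..l'}. ennreal (\<eta> i \<omega> + b * \<theta> i \<omega> + 1 / (real r + 1)))"
      by (intro sum_mono drift_le)
    also have "\<dots> = ennreal (\<Sum>i\<in>{n..l'}. \<eta> i \<omega> + b * \<theta> i \<omega> + 1 / (real r + 1))"
      using \<eta>_nonneg[OF \<omega>] \<theta>_nonneg[OF \<omega>] \<open>0 < b\<close> by (intro sum_ennreal) auto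
    also have "\<dots> \<le> ennreal (2 * \<sigma> * b)"
      using sum_le by (rule ennreal_leI)
    finally have "(\<Sum>i\<in>{n..l'}. drift (V c) i \<omega>) \<le> ennreal (2 * \<sigma> * b)" .
    moreover have "ennreal b \<le> V c (Suc l') \<omega>"
      using l(2) l'(1) by (auto simp: V_def g_def intro: ennreal_leI)
    moreover have "\<forall>i\<in>{n..l'}. V c i \<omega> < ennreal b"
      using below l'(1) g_nonneg by (auto simp: V_def g_def[symmetric] intro!: ennreal_lessI \<open>0 < b\<close>)
    moreover have "l' \<in> {n..<N}"
      using l' \<open>l \<le> m\<close> m by auto
    ultimately have "\<omega> \<in> Hit n c"
      using A_\<omega> unfolding Hit_def crossing_def by blast
    then show False
      using out n c by (auto simp: Hits_def)
  qed
  then have "prob {\<omega>\<in>space M. \<exists>n\<in>{N0..N}. \<exists>c\<in>C. \<exists>m\<in>{n..N}. \<omega> \<in> A n c \<and> \<epsilon> < dist (x m \<omega>) c}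
      \<le> prob (Ex \<union> Tl \<union> Hits)"
    using Ex_M Tl_M Hits_M by (intro finite_measure_mono) auto
  also have "\<dots> \<le> prob (Ex \<union> Tl) + prob Hits"
    using Ex_M Tl_M Hits_M by (intro measure_Un_le) auto
  also have "\<dots> \<le> prob Ex + prob Tl + prob Hits"
    using Ex_M Tl_M by (intro add_right_mono measure_Un_le) auto
  also have "\<dots> \<le> 5 * \<sigma>"
    using Ex_prob Tl_prob Hits_prob by simp
  finally show ?thesis .
qed
section \<open>Almost sure convergence\<close>

text \<open>
  By total boundedness and the recurrence to \<open>AF K\<close>, almost every path is at some return time \<open>n\<close> in
  one of the finitely many balls that meet all the sets \<open>AF k\<close>. The previous bound, being uniform in the
  horizon, passes to the increasing union of the escape events.
\<close>
lemma few_escapes: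
  fixes x :: "nat \<Rightarrow> 'w \<Rightarrow> 'a::metric_space" and G :: "real \<Rightarrow> real"
    and AF :: "nat \<Rightarrow> 'a set" and X\<^sub>0 :: "'a set"
  assumes X\<^sub>0: "totally_bounded X\<^sub>0"
    and AF_borel: "\<And>k. AF k \<in> sets borel" and AF_dec: "\<And>k. AF (Suc k) \<subseteq> AF k"
    and AF_sub: "\<And>k. AF k \<subseteq> X\<^sub>0"
    and G_nonneg: "\<And>t. 0 \<le> t \<Longrightarrow> 0 \<le> G t" and G_mono: "strict_mono_on {0..} G"
    and G_cont: "continuous_on {0..} G" and G_0: "G 0 = 0"
    and Fejer: "unif_stoch_quasi_Fejer M \<F> G AF x"
    and returns: "stoch_liminf_property M AF x"
    and "0 < \<epsilon>" "0 < \<sigma>"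
  shows "\<exists>C. finite C \<and> prob {\<omega>\<in>space M. \<forall>c\<in>C. \<forall>n. \<exists>m\<ge>n. \<epsilon> < dist (x m \<omega>) c} \<le> 5 * \<sigma>"
proof -
  obtain \<eta> \<theta> where x: "adapted \<F> x" and \<eta>: "\<eta> \<in> ell1_plus M \<F>" and \<theta>: "\<theta> \<in> ell1_plus M \<F>"
    and Fejer': "\<forall>\<tau>>0. \<forall>r n::nat. \<exists>k. \<forall>z\<in>AF k. \<forall>m\<le>n.
      prob {\<omega>\<in>space M. nn_cond_exp M (\<F> m) (\<lambda>\<omega>'. ennreal (G (dist (x (Suc m) \<omega>') z))) \<omega>
        > ennreal ((1 + \<theta> m \<omega>) * G (dist (x m \<omega>) z) + \<eta> m \<omega> + 1 / (real r + 1))} < \<tau>"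
    using Fejer unfolding unif_stoch_quasi_Fejer_def by blast
  have x_F: "x m \<in> borel_measurable (\<F> n)" if "m \<le> n" for m n
    using adapted_borel_measurable_filtration[OF x that] .
  have x_M: "x m \<in> borel_measurable M" for m
    using adapted_borel_measurable[OF x] .
  have dist_M [measurable]: "(\<lambda>\<omega>. dist (x m \<omega>) u) \<in> borel_measurable M" for m u
    using dist_borel_measurable[OF x_M] .
  define b where "b = G (\<epsilon> / 2)"
  have "0 < b"
    using strict_mono_onD[OF G_mono, of 0 "\<epsilon> / 2"] \<open>0 < \<epsilon>\<close> G_0 by (simp add: b_def)
  obtain \<rho> where \<rho>: "0 < \<rho>" "4 * \<rho> \<le> \<epsilon>" "G (2 * \<rho>) \<le> \<sigma> * b"
  proof -
    have "0 < \<sigma> * b" using \<open>0 < \<sigma>\<close> \<open>0 < b\<close> by simp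
    then obtain d where d: "0 < d" "\<And>t. 0 \<le> t \<Longrightarrow> dist t 0 < d \<Longrightarrow> dist (G t) (G 0) < \<sigma> * b"
      using G_cont unfolding continuous_on_iff by (metis atLeast_iff order_refl)
    define \<rho> where "\<rho> = min (d / 4) (\<epsilon> / 4)"
    have \<rho>: "0 < \<rho>" "4 * \<rho> \<le> \<epsilon>" "2 * \<rho> < d"
      using d(1) \<open>0 < \<epsilon>\<close> by (auto simp: \<rho>_def min_def)
    then have "\<bar>G (2 * \<rho>)\<bar> < \<sigma> * b"
      using d(2)[of "2 * \<rho>"] G_0 by (simp add: dist_real_def)
    then have "G (2 * \<rho>) \<le> \<sigma> * b"
      by linarith
    with \<rho>(1,2) show thesis
      by (rule that)
  qed
  obtain C\<^sub>0 where C\<^sub>0: "finite C\<^sub>0" "X\<^sub>0 \<subseteq> (\<Union>c\<in>C\<^sub>0. {y. dist c y < \<rho>})"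
    using X\<^sub>0 \<rho>(1) unfolding totally_bounded_metric by blast
  define C where "C = {c\<in>C\<^sub>0. \<forall>k. \<exists>z\<in>AF k. dist z c < \<rho>}"
  have "finite C" using C\<^sub>0(1) by (simp add: C_def)
  have AF_le: "AF k \<subseteq> AF j" if "j \<le> k" for j k
    using lift_Suc_antimono_le[of AF, OF AF_dec that] .
  have "\<exists>k. \<forall>z\<in>AF k. \<not> dist z c < \<rho>" if "c \<in> C\<^sub>0 - C" for c
    using that by (auto simp: C_def)
  then obtain miss where miss: "\<And>c z. c \<in> C\<^sub>0 - C \<Longrightarrow> z \<in> AF (miss c) \<Longrightarrow> \<not> dist z c < \<rho>"
    by metis
  \<comment> \<open>The sum serves as an upper bound of the finitely many indices \<open>miss c\<close>.\<close>
  define K where "K = (\<Sum>c\<in>C\<^sub>0. miss c)"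
  have AF_K: "\<exists>c\<in>C. dist z c < \<rho>" if z: "z \<in> AF K" for z
  proof -
    obtain c where c: "c \<in> C\<^sub>0" "dist z c < \<rho>"
      using C\<^sub>0(2) AF_sub z by (force simp: dist_commute)
    have "miss c \<le> K"
      unfolding K_def using C\<^sub>0(1) c(1) by (intro member_le_sum) auto
    then have "c \<in> C"
      using miss[of c z] AF_le[of "miss c" K] z c by blast
    with c show ?thesis by blast
  qed
  have \<eta>\<theta>_M: "\<eta> n \<in> borel_measurable M" "\<theta> n \<in> borel_measurable M" for n
    using \<eta> \<theta> by (simp_all add: ell1_plus_def adapted_borel_measurable)
  obtain N0 where N0: "prob {\<omega>\<in>space M. \<exists>l. \<sigma> * b < (\<Sum>i\<in>{N0..<l}. \<eta> i \<omega> + b * \<theta> i \<omega>)} \<le> \<sigma>"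
  proof -
    have "AE \<omega> in M. summable (\<lambda>n. \<eta> n \<omega>)" "AE \<omega> in M. summable (\<lambda>n. \<theta> n \<omega>)"
      using \<eta> \<theta> by (simp_all add: ell1_plus_def)
    then have "AE \<omega> in M. summable (\<lambda>n. \<eta> n \<omega> + b * \<theta> n \<omega>)"
      by eventually_elim (intro summable_add summable_mult)
    moreover have "0 \<le> \<eta> n \<omega> + b * \<theta> n \<omega>" if "\<omega> \<in> space M" for n \<omega>
      using \<eta> \<theta> that \<open>0 < b\<close> by (auto simp: ell1_plus_def)
    ultimately show thesis
      using summable_uniform_tail[of "\<lambda>n \<omega>. \<eta> n \<omega> + b * \<theta> n \<omega>" "\<sigma> * b" \<sigma>] that
        \<eta>\<theta>_M \<open>0 < b\<close> \<open>0 < \<sigma>\<close> by auto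
  qed
  obtain idx :: "'a \<Rightarrow> nat" where idx: "inj_on idx C"
    using finite_imp_inj_to_nat_seg[OF \<open>finite C\<close>] by blast
  \<comment> \<open>\<open>n\<close> is the first time from \<open>N0\<close> on with \<open>x n \<in> AF K\<close>, and \<open>c\<close> is, in the enumeration \<open>idx\<close>, the first
      centre near \<open>x n\<close>. Choosing first elements makes these events disjoint.\<close>
  define A where "A n c = {\<omega>\<in>space (\<F> n). (\<forall>i\<in>{N0..<n}. x i \<omega> \<notin> AF K) \<and> x n \<omega> \<in> AF K \<and>
      dist (x n \<omega>) c < \<rho> \<and> (\<forall>c'\<in>C. idx c' < idx c \<longrightarrow> \<not> dist (x n \<omega>) c' < \<rho>)}" for n c
  have A_F: "A n c \<in> sets (\<F> n)" for n c
  proof -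
    have [measurable]: "Measurable.pred (\<F> n) (\<lambda>\<omega>. x i \<omega> \<in> AF K)" if "i \<le> n" for i
      by (rule pred_sets2[OF AF_borel x_F[OF that]])
    have [measurable]: "(\<lambda>\<omega>. dist (x n \<omega>) u) \<in> borel_measurable (\<F> n)" for u
      using dist_borel_measurable[OF x_F[OF order_refl]] .
    have "Measurable.pred (\<F> n) (\<lambda>\<omega>. \<forall>i\<in>{N0..<n}. x i \<omega> \<notin> AF K)"
      by (intro pred_intros_finite) auto
    moreover have "Measurable.pred (\<F> n) (\<lambda>\<omega>. \<forall>c'\<in>C. idx c' < idx c \<longrightarrow> \<not> dist (x n \<omega>) c' < \<rho>)"
      using \<open>finite C\<close> by (intro pred_intros_finite) auto
    ultimately show ?thesis
      unfolding A_def by measurable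
  qed
  have space_A: "A n c = {\<omega>\<in>space M. (\<forall>i\<in>{N0..<n}. x i \<omega> \<notin> AF K) \<and> x n \<omega> \<in> AF K \<and>
      dist (x n \<omega>) c < \<rho> \<and> (\<forall>c'\<in>C. idx c' < idx c \<longrightarrow> \<not> dist (x n \<omega>) c' < \<rho>)}" for n c
    unfolding A_def space_F ..
  have A_disj: "disjoint_family_on (\<lambda>(n, c). A n c) ({N0..} \<times> C)"
  proof -
    have "n = n' \<and> c = c'" if "\<omega> \<in> A n c" "\<omega> \<in> A n' c'" "N0 \<le> n" "N0 \<le> n'" "c \<in> C" "c' \<in> C" for \<omega> n n' c c'
    proof -
      have "n = n'"
        using that by (cases n n' rule: linorder_cases) (auto simp: space_A)
      moreover have "idx c = idx c'"
        using that \<open>n = n'\<close> by (cases "idx c" "idx c'" rule: linorder_cases) (auto simp: space_A)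
      ultimately show ?thesis
        using idx that by (auto dest: inj_onD)
    qed
    then show ?thesis
      by (fastforce simp: disjoint_family_on_def)
  qed
  define Bad where "Bad N = {\<omega>\<in>space M. \<exists>n\<in>{N0..N}. \<exists>c\<in>C. \<exists>m\<in>{n..N}. \<omega> \<in> A n c \<and> \<epsilon> < dist (x m \<omega>) c}" for N
  have Bad_prob: "prob (Bad N) \<le> 5 * \<sigma>" for N
    unfolding Bad_def
  proof (rule few_escapes_before_horizon[OF x \<eta> \<theta> G_nonneg G_mono G_cont Fejer' \<open>finite C\<close> _ A_F])
    show "\<exists>z\<in>AF k. dist z c < \<rho>" if "c \<in> C" for c k
      using that by (simp add: C_def)
    show "dist (x n \<omega>) c < \<rho>" if "\<omega> \<in> A n c" for n c \<omega>
      using that by (simp add: A_def)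
  qed (use A_disj \<rho> \<open>0 < \<sigma>\<close> \<open>0 < b\<close> N0 in \<open>auto simp: b_def\<close>)
  have Bad_sets: "range Bad \<subseteq> sets M"
  proof -
    have [measurable]: "A n c \<in> sets M" for n c
      using A_F sets_filtration_subset by blast
    have "Bad N = (\<Union>n\<in>{N0..N}. \<Union>c\<in>C. \<Union>m\<in>{n..N}. A n c \<inter> {\<omega>\<in>space M. \<epsilon> < dist (x m \<omega>) c})" for N
      by (auto simp: Bad_def)
    moreover have "\<dots> N \<in> sets M" for N
      using \<open>finite C\<close> by (intro sets.finite_UN) auto
    ultimately show ?thesis by auto
  qed
  have "incseq Bad"
    unfolding incseq_def Bad_def by (auto intro: order.trans) (meson atLeastAtMost_iff order.trans)+
  then have "(\<lambda>N. prob (Bad N)) \<longlonglongrightarrow> prob (\<Union>N. Bad N)"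
    using Bad_sets by (intro finite_Lim_measure_incseq)
  then have Bad_Union: "prob (\<Union>N. Bad N) \<le> 5 * \<sigma>"
    by (rule LIMSEQ_le_const2) (use Bad_prob in auto)
  have "AE \<omega> in M. \<omega> \<in> {\<omega>\<in>space M. \<forall>c\<in>C. \<forall>n. \<exists>m\<ge>n. \<epsilon> < dist (x m \<omega>) c} \<longrightarrow> \<omega> \<in> (\<Union>N. Bad N)"
    using returns unfolding stoch_liminf_property_def
  proof eventually_elim
    case (elim \<omega>)
    show ?case
    proof
      assume "\<omega> \<in> {\<omega>\<in>space M. \<forall>c\<in>C. \<forall>n. \<exists>m\<ge>n. \<epsilon> < dist (x m \<omega>) c}"
      then have \<omega>: "\<omega> \<in> space M" and far: "\<And>c n. c \<in> C \<Longrightarrow> \<exists>m\<ge>n. \<epsilon> < dist (x m \<omega>) c"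
        by auto
      define n where "n = (LEAST n. N0 \<le> n \<and> x n \<omega> \<in> AF K)"
      have n: "N0 \<le> n" "x n \<omega> \<in> AF K"
        using LeastI_ex[of "\<lambda>n. N0 \<le> n \<and> x n \<omega> \<in> AF K"] elim by (auto simp: n_def)
      have first: "x i \<omega> \<notin> AF K" if "N0 \<le> i" "i < n" for i
        using not_less_Least[of i "\<lambda>n. N0 \<le> n \<and> x n \<omega> \<in> AF K"] that by (auto simp: n_def)
      obtain c where c: "c \<in> C" "dist (x n \<omega>) c < \<rho>"
        and c_min: "\<And>c'. c' \<in> C \<Longrightarrow> dist (x n \<omega>) c' < \<rho> \<Longrightarrow> idx c \<le> idx c'"
      proof -
        obtain c' where c': "c' \<in> C \<and> dist (x n \<omega>) c' < \<rho>"
          using AF_K[OF n(2)] by blast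
        from arg_min_nat_lemma[of "\<lambda>c. c \<in> C \<and> dist (x n \<omega>) c < \<rho>", OF c', of idx] show thesis
          by (intro that) auto
      qed
      have A_\<omega>: "\<omega> \<in> A n c"
        using \<omega> n c c_min first by (force simp: space_A not_le[symmetric])
      obtain m where "n \<le> m" "\<epsilon> < dist (x m \<omega>) c"
        using far[OF c(1)] by blast
      then have "\<omega> \<in> Bad m"
        using \<omega> n c A_\<omega> by (force simp: Bad_def)
      then show "\<omega> \<in> (\<Union>N. Bad N)" by blast
    qed
  qed
  then have "prob {\<omega>\<in>space M. \<forall>c\<in>C. \<forall>n. \<exists>m\<ge>n. \<epsilon> < dist (x m \<omega>) c} \<le> prob (\<Union>N. Bad N)"
    using Bad_sets by (intro finite_measure_mono_AE) auto
  with Bad_Union \<open>finite C\<close> show ?thesis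
    by (blast intro: order.trans)
qed

text \<open>
  The centres may depend on \<open>\<sigma>\<close>: intersecting the escape events over a sequence \<open>\<sigma> \<longlonglongrightarrow> 0\<close>
  leaves a null set, outside of which the path is eventually within \<open>\<epsilon>\<close> of some point.
\<close>
lemma AE_Cauchy_if_few_escapes:
  fixes x :: "nat \<Rightarrow> 'w \<Rightarrow> 'a::metric_space"
  assumes x_M: "\<And>n. x n \<in> borel_measurable M"
    and escapes: "\<And>\<epsilon> \<sigma>. 0 < \<epsilon> \<Longrightarrow> 0 < \<sigma> \<Longrightarrow>
      \<exists>C. finite C \<and> prob {\<omega>\<in>space M. \<forall>c\<in>C. \<forall>n. \<exists>m\<ge>n. \<epsilon> < dist (x m \<omega>) c} \<le> \<sigma>"
  shows "AE \<omega> in M. Cauchy (\<lambda>n. x n \<omega>)"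
proof -
  have dist_M [measurable]: "(\<lambda>\<omega>. dist (x m \<omega>) u) \<in> borel_measurable M" for m u
    using dist_borel_measurable[OF x_M] .
  have settles: "AE \<omega> in M. \<exists>c n. \<forall>m\<ge>n. dist (x m \<omega>) c \<le> \<epsilon>" if "0 < \<epsilon>" for \<epsilon>
  proof -
    define Bad where "Bad C = {\<omega>\<in>space M. \<forall>c\<in>C. \<forall>n. \<exists>m\<ge>n. \<epsilon> < dist (x m \<omega>) c}" for C
    have "\<exists>C. \<forall>i. finite (C i) \<and> prob (Bad (C i)) \<le> inverse (real (Suc i))"
      unfolding Bad_def by (intro choice allI escapes[OF that]) simp
    then obtain C where C: "\<And>i. finite (C i)" "\<And>i. prob (Bad (C i)) \<le> inverse (real (Suc i))"
      by blast
    have Bad_M: "Bad (C i) \<in> sets M" for i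
      unfolding Bad_def using countable_finite[OF C(1)[of i]] by measurable
    have "prob (\<Inter>i. Bad (C i)) \<le> inverse (real (Suc i))" for i
      using Bad_M by (intro order.trans[OF finite_measure_mono C(2)[of i]]) auto
    then have "prob (\<Inter>i. Bad (C i)) \<le> 0"
      by (intro LIMSEQ_le_const[OF LIMSEQ_inverse_real_of_nat]) auto
    then have "(\<Inter>i. Bad (C i)) \<in> null_sets M"
      using Bad_M by (auto simp: null_sets_def emeasure_eq_measure measure_le_0_iff)
    then show ?thesis
      by (rule AE_I') (auto simp: Bad_def not_le[symmetric])
  qed
  have "AE \<omega> in M. \<forall>j. \<exists>c n. \<forall>m\<ge>n. dist (x m \<omega>) c \<le> inverse (real (Suc j))"
    by (subst AE_all_countable) (intro allI settles, simp)
  then show ?thesis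
  proof eventually_elim
    case (elim \<omega>)
    show ?case
      unfolding Cauchy_def
    proof (intro allI impI)
      fix e :: real assume "0 < e"
      then obtain j where j: "inverse (real (Suc j)) < e / 2"
        using reals_Archimedean[of "e / 2"] by auto
      obtain c n where near: "\<And>m. n \<le> m \<Longrightarrow> dist (x m \<omega>) c \<le> inverse (real (Suc j))"
        using elim by blast
      have "dist (x m \<omega>) (x m' \<omega>) < e" if "n \<le> m" "n \<le> m'" for m m'
        using near[OF that(1)] near[OF that(2)] j dist_triangle2[of "x m \<omega>" "x m' \<omega>" c] by linarith
      then show "\<exists>n. \<forall>m\<ge>n. \<forall>m'\<ge>n. dist (x m \<omega>) (x m' \<omega>) < e"
        by blast
    qed
  qed
qed
end

theorem theorem4p21:
  fixes M :: "'w measure"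
    and \<F> :: "nat \<Rightarrow> 'w measure"
    and p :: "'a::metric_space"
    and X\<^sub>0 F :: "'a set"
    and AF :: "nat \<Rightarrow> 'a set"
    and D :: real
    and G :: "real \<Rightarrow> real"
    and x :: "nat \<Rightarrow> 'w \<Rightarrow> 'a"
  assumes "prob_space M"
    and "totally_bounded X\<^sub>0"
    and "\<And>z. z \<in> X\<^sub>0 \<Longrightarrow> dist z p \<le> D"
    and "F \<noteq> {}" and "F = (\<Inter>k. AF k)"
    and "\<And>k. AF k \<in> sets borel"
    and "\<And>k. AF (Suc k) \<subseteq> AF k" and "\<And>k. AF k \<subseteq> X\<^sub>0"
    and "\<And>t. 0 \<le> t \<Longrightarrow> 0 \<le> G t"
    and "strict_mono_on {0..} G" and "continuous_on {0..} G" and "G 0 = 0"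
    and "filtration (space M) \<F>" and "\<And>n. subalgebra M (\<F> n)"
    and "\<And>n. x n \<in> borel_measurable M"
    and "unif_stoch_quasi_Fejer M \<F> G AF x"
    and "stoch_liminf_property M AF x"
    and "AE \<omega> in M. (SUP n. ennreal (dist (x n \<omega>) p)) < \<infinity>"
    and "integrable M (\<lambda>\<omega>. G (dist (x 0 \<omega>) p + D))"
  shows "AE \<omega> in M. Cauchy (\<lambda>n. x n \<omega>)"
proof -
  interpret prob_space M by fact
  interpret filtration "space M" \<F> by fact
  interpret filtered_prob_space M \<F>
    by unfold_locales fact
  show ?thesis
  proof (rule AE_Cauchy_if_few_escapes)
    fix \<epsilon> \<sigma> :: real assume "0 < \<epsilon>" "0 < \<sigma>"
    then show "\<exists>C. finite C \<and> prob {\<omega>\<in>space M. \<forall>c\<in>C. \<forall>n. \<exists>m\<ge>n. \<epsilon> < dist (x m \<omega>) c} \<le> \<sigma>"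
      using few_escapes[OF assms(2,6-12,16,17), of \<epsilon> "\<sigma> / 5"] by simp
  qed fact
qed

end
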